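(* Let $n\ge1$ be an integer and let $\mathcal{C}_1$ be any smooth closed loop homotopic in $\mathbb{C}\setminus\{1\}$ to the positively oriented circle centered at $1$ of some radius $R\in(0,1)$. Then for all $x=(x_1,\dots,x_n)$ sufficiently near $0$ in $\mathbb{C}^n$, $$G_n(x)=\frac{1}{(2\pi i)^n}\int_{\mathcal{C}_1^n}\prod_{j=1}^n \mathcal{S}(\bar x_j;\bar t_j)\,\frac{dt_j}{t_j},$$ where $\bar x_j=(x_j,\dots,x_n)$ and $\bar t_j=(t_j,\dots,t_n)$ for $1\le j\le n$, with $t=(t_1,\dots,t_n)$.
   Context: For $n\ge 1$, $G_n(x)=\sum_{\ell\in\mathbb{N}^n}\bigl(\frac{|\ell|!}{\ell!}\bigr)^2x^\ell$ (with $\mathbb{N}=\{0,1,2,\dots\}$, $x^\ell=x_1^{\ell_1}\cdots x_n^{\ell_n}$, $|\ell|=\ell_1+\dots+\ell_n$, $\ell!=\ell_1!\cdots\ell_n!$), a convergent power series near $0\in\mathbb{C}^n$. The functions $\mathcal{S}$ are defined recursively: for a scalar $a$, $$\mathcal{S}(a;t)=\frac{t}{(t-1)(1-at)},$$ and for $m\ge2$, $$\mathcal{S}(a_1,\dots,a_m;t_1,\dots,t_m)=\mathcal{S}\bigl(\mathcal{S}(a_m;t_m)\,a_1,\dots,\mathcal{S}(a_m;t_m)\,a_{m-1};\,t_1,\dots,t_{m-1}\bigr).$$ (These formulas also make sense when some of the $a_j$ vanish.) "Sufficiently near $0$" is relative to the chosen loop $\mathcal{C}_1$. The integrand $\mathcal{S}(\bar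 x_j;\bar t_j)/t_j$ is understood with the common factor $t_j$ cancelled. *)

theory Defs
  imports "HOL-Complex_Analysis.Complex_Analysis"
begin

text \<open>
  Points of \<open>\<complex>\<^sup>n\<close> and multi-indices in \<open>\<nat>\<^sup>n\<close> are functions on \<open>nat\<close> of which only the values
  at \<open>1, \<dots>, n\<close> matter; multi-indices are extensional on \<open>{1..n}\<close>, so that each one is
  counted exactly once.
\<close>

definition G_term :: "nat \<Rightarrow> (nat \<Rightarrow> complex) \<Rightarrow> (nat \<Rightarrow> nat) \<Rightarrow> complex" where
  "G_term n x l = (fact (\<Sum>i=1..n. l i) / (\<Prod>i=1..n. fact (l i)))\<^sup>2 * (\<Prod>i=1..n. x i ^ l i)"

definition multi_indices :: "nat \<Rightarrow> (nat \<Rightarrow> nat) set" where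
  "multi_indices n = {1..n} \<rightarrow>\<^sub>E UNIV"

definition G :: "nat \<Rightarrow> (nat \<Rightarrow> complex) \<Rightarrow> complex" where
  "G n x = (\<Sum>\<^sub>\<infinity>l\<in>multi_indices n. G_term n x l)"

definition S1 :: "complex \<Rightarrow> complex \<Rightarrow> complex" where
  "S1 a t = t / ((t - 1) * (1 - a * t))"

text \<open>\<open>S m a t\<close> is \<open>\<S>(a\<^sub>1, \<dots>, a\<^sub>m; t\<^sub>1, \<dots>, t\<^sub>m)\<close>; it is only meaningful for \<open>m \<ge> 1\<close>.\<close>

fun S :: "nat \<Rightarrow> (nat \<Rightarrow> complex) \<Rightarrow> (nat \<Rightarrow> complex) \<Rightarrow> complex" where
  "S (Suc 0) a t = S1 (a 1) (t 1)"
| "S (Suc (Suc m)) a t = S (Suc m) (\<lambda>i. S1 (a (Suc (Suc m))) (t (Suc (Suc m))) * a i) t"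

text \<open>
  \<open>S_cancelled m a t\<close> is \<open>\<S>(a\<^sub>1, \<dots>, a\<^sub>m; t\<^sub>1, \<dots>, t\<^sub>m) / t\<^sub>1\<close> with the common factor \<open>t\<^sub>1\<close> cancelled:
  the recursion ends in \<open>\<S>(c; t\<^sub>1) = t\<^sub>1 / ((t\<^sub>1 - 1) (1 - c t\<^sub>1))\<close> with \<open>c\<close> independent of \<open>t\<^sub>1\<close>.
  A loop homotopic to the circle in \<open>\<complex> - {1}\<close> may pass through \<open>0\<close>, where the literal
  quotient would be \<open>0 / 0 = 0\<close>.
\<close>

fun S_cancelled :: "nat \<Rightarrow> (nat \<Rightarrow> complex) \<Rightarrow> (nat \<Rightarrow> complex) \<Rightarrow> complex" where
  "S_cancelled (Suc 0) a t = 1 / ((t 1 - 1) * (1 - a 1 * t 1))"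
| "S_cancelled (Suc (Suc m)) a t =
     S_cancelled (Suc m) (\<lambda>i. S1 (a (Suc (Suc m))) (t (Suc (Suc m))) * a i) t"

lemma S_eq_S_cancelled:
  assumes "m \<ge> 1"
  shows "S m a t = t 1 * S_cancelled m a t"
  using assms by (induction m a t rule: S.induct) (auto simp: S1_def)

lemma S_cancelled_eq_S_divide:
  assumes "m \<ge> 1" "t 1 \<noteq> 0"
  shows "S_cancelled m a t = S m a t / t 1"
  using assms by (simp add: S_eq_S_cancelled)

text \<open>The tail \<open>(x\<^sub>j, x\<^sub>j\<^sub>+\<^sub>1, \<dots>)\<close>, renumbered from \<open>1\<close> (for \<open>j \<ge> 1\<close>).\<close>

definition tail_from :: "nat \<Rightarrow> (nat \<Rightarrow> complex) \<Rightarrow> nat \<Rightarrow> complex" where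
  "tail_from j x = (\<lambda>i. x (j + i - 1))"

definition smooth_path :: "(real \<Rightarrow> complex) \<Rightarrow> bool" where
  "smooth_path \<gamma> \<longleftrightarrow> (\<exists>\<gamma>'. continuous_on {0..1} \<gamma>' \<and>
     (\<forall>s\<in>{0..1}. (\<gamma> has_vector_derivative \<gamma>' s) (at s within {0..1})))"

text \<open>
  The integral of \<open>f(t\<^sub>1, \<dots>, t\<^sub>n) dt\<^sub>1 \<dots> dt\<^sub>n\<close> over the \<open>n\<close>-fold product of the path \<open>\<gamma>\<close> with
  itself, as the integral over the cube \<open>[0,1]\<^sup>n\<close> of the pullback along \<open>t\<^sub>i = \<gamma>(s\<^sub>i)\<close>.
\<close>

definition unit_cube_measure :: "nat \<Rightarrow> (nat \<Rightarrow> real) measure" where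
  "unit_cube_measure n = (\<Pi>\<^sub>M i\<in>{1..n}. restrict_space lborel {0..1})"

definition path_power_pullback ::
    "nat \<Rightarrow> (real \<Rightarrow> complex) \<Rightarrow> ((nat \<Rightarrow> complex) \<Rightarrow> complex) \<Rightarrow> (nat \<Rightarrow> real) \<Rightarrow> complex" where
  "path_power_pullback n \<gamma> f s =
     f (\<lambda>i. \<gamma> (s i)) * (\<Prod>i=1..n. vector_derivative \<gamma> (at (s i) within {0..1}))"

definition path_power_integrable ::
    "nat \<Rightarrow> (real \<Rightarrow> complex) \<Rightarrow> ((nat \<Rightarrow> complex) \<Rightarrow> complex) \<Rightarrow> bool" where
  "path_power_integrable n \<gamma> f \<longleftrightarrow>
     integrable (unit_cube_measure n) (path_power_pullback n \<gamma> f)"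

definition path_power_integral ::
    "nat \<Rightarrow> (real \<Rightarrow> complex) \<Rightarrow> ((nat \<Rightarrow> complex) \<Rightarrow> complex) \<Rightarrow> complex" where
  "path_power_integral n \<gamma> f =
     integral\<^sup>L (unit_cube_measure n) (path_power_pullback n \<gamma> f)"

definition S_integrand :: "nat \<Rightarrow> (nat \<Rightarrow> complex) \<Rightarrow> (nat \<Rightarrow> complex) \<Rightarrow> complex" where
  "S_integrand n x t = (\<Prod>j=1..n. S_cancelled (n - j + 1) (tail_from j x) (tail_from j t))"

lemma S_integrand_eq:
  assumes "\<And>j. j \<in> {1..n} \<Longrightarrow> t j \<noteq> 0"
  shows "S_integrand n x t = (\<Prod>j=1..n. S (n - j + 1) (tail_from j x) (tail_from j t) / t j)"
  unfolding S_integrand_def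
  by (intro prod.cong) (use assms in \<open>auto simp: S_cancelled_eq_S_divide tail_from_def\<close>)

end

theory Submission
  imports Defs "HOL-Probability.Infinite_Product_Measure"
begin

text \<open>
  With \<open>c = \<S>(x\<^sub>n; t\<^sub>n)\<close>, the integrand for \<open>n\<close> variables at \<open>x\<close> is the integrand for \<open>n - 1\<close>
  variables at \<open>(c x\<^sub>1, \<dots>, c x\<^sub>n\<^sub>-\<^sub>1)\<close> times \<open>1 / ((t\<^sub>n - 1) (1 - x\<^sub>n t\<^sub>n))\<close>. So by induction the
  multiple integral is a single contour integral of \<open>G\<^sub>n\<^sub>-\<^sub>1(c x\<^sub>1, \<dots>, c x\<^sub>n\<^sub>-\<^sub>1)\<close> against this
  factor. Expanding \<open>G\<^sub>n\<^sub>-\<^sub>1\<close>, the terms of total degree \<open>k\<close> pick up the factor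
  \<open>\<Sum>m. (k + m choose m)\<^sup>2 x\<^sub>n\<^sup>m\<close>, which is how the coefficients of \<open>G\<^sub>n\<close> arise from those of
  \<open>G\<^sub>n\<^sub>-\<^sub>1\<close>.
\<close>

section \<open>Neighbourhoods of the origin\<close>

text \<open>
  Points of \<open>\<complex>\<^sup>n\<close> are functions on all of \<open>nat\<close>, so this filter is not a neighbourhood filter of
  the product topology: it disregards the coordinates outside \<open>{1..n}\<close>.
\<close>

definition nhds_origin :: "nat \<Rightarrow> (nat \<Rightarrow> complex) filter" where
  "nhds_origin n = (INF \<epsilon>\<in>{0<..}. principal {x. \<forall>i\<in>{1..n}. norm (x i) < \<epsilon>})"

lemma eventually_nhds_origin:
  "eventually P (nhds_origin n) \<longleftrightarrow> (\<exists>\<epsilon>>0. \<forall>x. (\<forall>i\<in>{1..n}. norm (x i) < \<epsilon>) \<longrightarrow> P x)"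
  unfolding nhds_origin_def
proof (subst eventually_INF_base)
  fix \<delta> \<epsilon> :: real
  assume "\<delta> \<in> {0<..}" "\<epsilon> \<in> {0<..}"
  then show "\<exists>\<eta>\<in>{0<..}. principal {x. \<forall>i\<in>{1..n}. norm (x i :: complex) < \<eta>} \<le>
      inf (principal {x. \<forall>i\<in>{1..n}. norm (x i) < \<delta>}) (principal {x. \<forall>i\<in>{1..n}. norm (x i) < \<epsilon>})"
    by (intro bexI[of _ "min \<delta> \<epsilon>"]) auto
qed (auto simp: eventually_principal Bex_def)

lemma eventually_nhds_origin_coordinate:
  assumes "eventually P (nhds 0)" "i < n"
  shows "\<forall>\<^sub>F x in nhds_origin n. P (x (Suc i))"
proof -
  obtain \<epsilon> where "\<epsilon> > 0" "\<And>a. norm a < \<epsilon> \<Longrightarrow> P a"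
    using assms(1) by (auto simp: eventually_nhds_metric)
  moreover have "Suc i \<in> {1..n}" using assms(2) by simp
  ultimately show ?thesis
    unfolding eventually_nhds_origin by blast
qed

lemma eventually_nhds_origin_dominated:
  assumes "eventually P (nhds_origin m)" "m \<le> n"
  shows "\<forall>\<^sub>F x in nhds_origin n. \<forall>y. (\<forall>i\<in>{1..m}. norm (y i) \<le> C * norm (x i)) \<longrightarrow> P y"
proof -
  obtain \<epsilon> where \<epsilon>: "\<epsilon> > 0" "\<And>y. (\<forall>i\<in>{1..m}. norm (y i) < \<epsilon>) \<Longrightarrow> P y"
    using assms(1) by (auto simp: eventually_nhds_origin)
  define \<delta> where "\<delta> = \<epsilon> / (\<bar>C\<bar> + 1)"
  have "\<delta> > 0" using \<epsilon>(1) by (simp add: \<delta>_def)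
  moreover have "P y"
    if x: "\<forall>i\<in>{1..n}. norm (x i) < \<delta>" and y: "\<forall>i\<in>{1..m}. norm (y i) \<le> C * norm (x i)" for x y
  proof (rule \<epsilon>(2), rule ballI)
    fix i assume i: "i \<in> {1..m}"
    have "norm (y i) \<le> C * norm (x i)" using y i by blast
    also have "\<dots> \<le> (\<bar>C\<bar> + 1) * norm (x i)" by (intro mult_right_mono) auto
    also have "\<dots> < (\<bar>C\<bar> + 1) * \<delta>"
      using x i \<open>m \<le> n\<close> by (intro mult_strict_left_mono) auto
    also have "\<dots> = \<epsilon>" by (simp add: \<delta>_def)
    finally show "norm (y i) < \<epsilon>" .
  qed
  ultimately show ?thesis
    unfolding eventually_nhds_origin by blast
qed


section \<open>The integrand\<close>

definition S1_cancelled :: "complex \<Rightarrow> complex \<Rightarrow> complex" where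
  "S1_cancelled a t = 1 / ((t - 1) * (1 - a * t))"

lemma S1_eq_S1_cancelled: "S1 a t = t * S1_cancelled a t"
  by (simp add: S1_def S1_cancelled_def)

lemma norm_S1_cancelled_le:
  assumes "norm (a * t) \<le> 1 / 2"
  shows "norm (S1_cancelled a t) \<le> 2 * norm (1 / (t - 1))"
proof -
  have "1 / 2 \<le> norm (1 - a * t)"
    using assms norm_triangle_ineq2[of 1 "a * t"] by simp
  then have "1 / norm (1 - a * t) \<le> 2"
    using frac_le[of 1 1 "1 / 2" "norm (1 - a * t)"] by simp
  then have "norm (1 / (t - 1)) * (1 / norm (1 - a * t)) \<le> norm (1 / (t - 1)) * 2"
    by (intro mult_left_mono) auto
  then show ?thesis
    by (simp add: S1_cancelled_def norm_mult norm_divide mult_ac)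
qed

lemma S1_bounded_near_0:
  assumes "compact T" "1 \<notin> T"
  obtains C where "\<forall>\<^sub>F a in nhds 0.
    \<forall>t\<in>T. norm (a * t) < 1 \<and> norm (S1 a t) \<le> C \<and> norm (S1_cancelled a t) \<le> C"
proof -
  obtain K where K: "K \<ge> 0" "\<And>t. t \<in> T \<Longrightarrow> norm t \<le> K"
    using continuous_on_compact_bound[OF assms(1) continuous_on_id] by blast
  have "continuous_on T (\<lambda>t. 1 / (t - 1))"
    using assms(2) by (auto intro!: continuous_intros)
  then obtain D where D: "D \<ge> 0" "\<And>t. t \<in> T \<Longrightarrow> norm (1 / (t - 1)) \<le> D"
    using continuous_on_compact_bound[OF assms(1)] by blast
  define C where "C = (K + 1) * (2 * D)"
  have bounds: "norm (a * t) < 1 \<and> norm (S1 a t) \<le> C \<and> norm (S1_cancelled a t) \<le> C"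
    if a: "norm a < 1 / (2 * (K + 1))" and t: "t \<in> T" for a t
  proof -
    have "norm (a * t) \<le> norm a * (K + 1)"
      using K(2)[OF t] by (auto simp: norm_mult intro!: mult_left_mono)
    also have "\<dots> < 1 / 2"
      using a K(1) by (simp add: field_simps)
    finally have at: "norm (a * t) < 1 / 2" .
    then have S1_cancelled: "norm (S1_cancelled a t) \<le> 2 * D"
      using norm_S1_cancelled_le[of a t] D(2)[OF t] by linarith
    also have "\<dots> \<le> C"
      using K(1) D(1) by (simp add: C_def mult_le_cancel_right1)
    finally have "norm (S1_cancelled a t) \<le> C" .
    moreover have "norm (S1 a t) \<le> C"
      using K(1) K(2)[OF t] S1_cancelled unfolding S1_eq_S1_cancelled norm_mult C_def
      by (intro mult_mono) auto
    ultimately show ?thesis using at by simp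
  qed
  have "\<forall>\<^sub>F a in nhds 0. norm (a :: complex) < 1 / (2 * (K + 1))"
    using K(1) by (auto simp: eventually_nhds_metric intro!: exI[of _ "1 / (2 * (K + 1))"])
  then have "\<forall>\<^sub>F a in nhds 0.
      \<forall>t\<in>T. norm (a * t) < 1 \<and> norm (S1 a t) \<le> C \<and> norm (S1_cancelled a t) \<le> C"
    by eventually_elim (use bounds in blast)
  then show thesis by (rule that)
qed

lemma S_integrand_0 [simp]: "S_integrand 0 x t = 1"
  by (simp add: S_integrand_def)

lemma S_integrand_Suc:
  "S_integrand (Suc n) x t =
     S_integrand n (\<lambda>i. S1 (x (Suc n)) (t (Suc n)) * x i) t * S1_cancelled (x (Suc n)) (t (Suc n))"
proof -
  let ?c = "S1 (x (Suc n)) (t (Suc n))"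
  have "S_cancelled (Suc n - j + 1) (tail_from j x) (tail_from j t) =
      S_cancelled (n - j + 1) (tail_from j (\<lambda>i. ?c * x i)) (tail_from j t)"
    if "j \<in> {1..n}" for j
  proof -
    have "Suc n - j + 1 = Suc (Suc (n - j))" "j + Suc (Suc (n - j)) - 1 = Suc n"
      using that by auto
    then show ?thesis by (simp add: tail_from_def)
  qed
  then show ?thesis
    by (simp add: S_integrand_def S1_cancelled_def tail_from_def)
qed

lemma S_integrand_cong:
  assumes "\<And>i. i \<in> {1..n} \<Longrightarrow> t i = u i"
  shows "S_integrand n x t = S_integrand n x u"
  using assms by (induction n arbitrary: x) (simp_all add: S_integrand_Suc)

lemma S_integrand_Suc_upd:
  "S_integrand (Suc n) x (t(Suc n := z)) =
     S_integrand n (\<lambda>i. S1 (x (Suc n)) z * x i) t * S1_cancelled (x (Suc n)) z"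
proof -
  have "S_integrand n y (t(Suc n := z)) = S_integrand n y t" for y
    by (rule S_integrand_cong) auto
  then show ?thesis by (simp add: S_integrand_Suc)
qed

lemma borel_measurable_S_integrand:
  assumes "\<And>i. i \<in> {1..n} \<Longrightarrow> (\<lambda>s. x s i) \<in> borel_measurable M"
    and "\<And>i. i \<in> {1..n} \<Longrightarrow> (\<lambda>s. t s i) \<in> borel_measurable M"
  shows "(\<lambda>s. S_integrand n (x s) (t s)) \<in> borel_measurable M"
  using assms
proof (induction n arbitrary: x)
  case (Suc n)
  have [measurable]: "(\<lambda>s. x s (Suc n)) \<in> borel_measurable M"
    "(\<lambda>s. t s (Suc n)) \<in> borel_measurable M"
    using Suc.prems by auto
  have "(\<lambda>s. S_integrand n (\<lambda>i. S1 (x s (Suc n)) (t s (Suc n)) * x s i) (t s)) \<in> borel_measurable M"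
  proof (rule Suc.IH)
    fix i assume "i \<in> {1..n}"
    then have [measurable]: "(\<lambda>s. x s i) \<in> borel_measurable M"
      using Suc.prems(1) by simp
    show "(\<lambda>s. S1 (x s (Suc n)) (t s (Suc n)) * x s i) \<in> borel_measurable M"
      unfolding S1_def by measurable
  qed (use Suc.prems(2) in auto)
  then show ?case
    by (simp add: S_integrand_Suc S1_cancelled_def)
qed simp

lemma S_integrand_bounded_near_origin:
  assumes "compact T" "1 \<notin> T"
  shows "\<exists>B. \<forall>\<^sub>F x in nhds_origin n. \<forall>t. (\<forall>i\<in>{1..n}. t i \<in> T) \<longrightarrow> norm (S_integrand n x t) \<le> B"
proof (induction n)
  case 0
  show ?case by (auto intro!: exI[of _ 1])
next
  case (Suc n)
  then obtain B where B:
    "\<forall>\<^sub>F x in nhds_origin n. \<forall>t. (\<forall>i\<in>{1..n}. t i \<in> T) \<longrightarrow> norm (S_integrand n x t) \<le> B"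
    by blast
  obtain C where C: "\<forall>\<^sub>F a in nhds 0.
      \<forall>t\<in>T. norm (a * t) < 1 \<and> norm (S1 a t) \<le> C \<and> norm (S1_cancelled a t) \<le> C"
    using S1_bounded_near_0[OF assms] .
  from eventually_nhds_origin_dominated[OF B le_SucI[OF order.refl], of C]
    eventually_nhds_origin_coordinate[OF C lessI]
  have "\<forall>\<^sub>F x in nhds_origin (Suc n). \<forall>t. (\<forall>i\<in>{1..Suc n}. t i \<in> T) \<longrightarrow>
      norm (S_integrand (Suc n) x t) \<le> B * C"
  proof eventually_elim
    case (elim x)
    show ?case
    proof (intro allI impI)
      fix t assume t: "\<forall>i\<in>{1..Suc n}. t i \<in> T"
      then have "norm (S1 (x (Suc n)) (t (Suc n)) * x i) \<le> C * norm (x i)" for i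
        using elim(2) by (auto simp: norm_mult intro!: mult_right_mono)
      then have "norm (S_integrand n (\<lambda>i. S1 (x (Suc n)) (t (Suc n)) * x i) t) \<le> B"
        using elim(1) t by simp
      moreover have "norm (S1_cancelled (x (Suc n)) (t (Suc n))) \<le> C"
        using elim(2) t by simp
      ultimately show "norm (S_integrand (Suc n) x t) \<le> B * C"
        unfolding S_integrand_Suc norm_mult by (meson mult_mono norm_ge_zero order_trans)
    qed
  qed
  then show ?case by blast
qed


section \<open>The power series\<close>

definition squared_binomial_series :: "nat \<Rightarrow> complex \<Rightarrow> complex" where
  "squared_binomial_series k z = (\<Sum>\<^sub>\<infinity>m. (of_nat (k + m choose m))\<^sup>2 * z ^ m)"

lemma multi_indices_0: "multi_indices 0 = {\<lambda>_. undefined}"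
  by (simp add: multi_indices_def)

lemma bij_betw_multi_indices_Suc:
  "bij_betw (\<lambda>(l, m). l(Suc n := m)) (multi_indices n \<times> UNIV) (multi_indices (Suc n))"
  unfolding bij_betw_def
proof
  show "inj_on (\<lambda>(l, m). l(Suc n := m)) (multi_indices n \<times> UNIV)"
    unfolding multi_indices_def by (rule inj_combinator') simp
  show "(\<lambda>(l, m). l(Suc n := m)) ` (multi_indices n \<times> UNIV) = multi_indices (Suc n)"
    by (force simp: multi_indices_def atLeastAtMostSuc_conv PiE_insert_eq image_iff)
qed

lemma G_term_0 [simp]: "G_term 0 x l = 1"
  by (simp add: G_term_def)

lemma G_term_Suc:
  "G_term (Suc n) x (l(Suc n := m)) =
     G_term n x l * ((of_nat ((\<Sum>i=1..n. l i) + m choose m))\<^sup>2 * x (Suc n) ^ m)"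
proof -
  have "(\<Sum>i=1..n. (l(Suc n := m)) i) = (\<Sum>i=1..n. l i)"
    "(\<Prod>i=1..n. fact ((l(Suc n := m)) i)) = (\<Prod>i=1..n. fact (l i) :: complex)"
    "(\<Prod>i=1..n. x i ^ (l(Suc n := m)) i) = (\<Prod>i=1..n. x i ^ l i)"
    by (auto intro!: sum.cong prod.cong)
  moreover have "(of_nat ((\<Sum>i=1..n. l i) + m choose m) :: complex) =
      fact ((\<Sum>i=1..n. l i) + m) / (fact m * fact (\<Sum>i=1..n. l i))"
    by (simp add: binomial_fact)
  ultimately show ?thesis
    by (simp add: G_term_def power_divide power_mult_distrib)
qed

lemma G_term_scale:
  "G_term n (\<lambda>i. c * x i) l = c ^ (\<Sum>i=1..n. l i) * G_term n x l"
  by (simp add: G_term_def power_mult_distrib prod.distrib power_sum)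

lemma norm_G_term_scale_mono:
  assumes "norm c \<le> norm d"
  shows "norm (G_term n (\<lambda>i. c * x i) l) \<le> norm (G_term n (\<lambda>i. d * x i) l)"
  unfolding G_term_scale norm_mult norm_power using assms by (intro mult_right_mono power_mono) auto

lemma summable_on_G_term_scale:
  assumes "G_term n (\<lambda>i. d * x i) summable_on multi_indices n" "norm c \<le> norm d"
  shows "G_term n (\<lambda>i. c * x i) summable_on multi_indices n"
  using assms(1) unfolding summable_on_iff_abs_summable_on_complex
  by (rule summable_on_comparison_test) (auto intro: norm_G_term_scale_mono assms(2))

lemma norm_summable_on_Times_mult:
  fixes f :: "'a \<Rightarrow> 'c :: real_normed_div_algebra" and g :: "'b \<Rightarrow> 'c"
  assumes "(\<lambda>x. norm (f x)) summable_on A" "(\<lambda>y. norm (g y)) summable_on B"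
  shows "(\<lambda>(x, y). norm (f x * g y)) summable_on A \<times> B"
proof (rule summable_on_SigmaI)
  show "((\<lambda>y. case (x, y) of (x, y) \<Rightarrow> norm (f x * g y)) has_sum
      norm (f x) * (\<Sum>\<^sub>\<infinity>y\<in>B. norm (g y))) B" for x
    using assms(2) by (simp add: norm_mult has_sum_cmult_right)
  show "(\<lambda>x. norm (f x) * (\<Sum>\<^sub>\<infinity>y\<in>B. norm (g y))) summable_on A"
    using assms(1) by (rule summable_on_cmult_left)
qed simp

lemma summable_on_G_term_Suc:
  assumes "G_term n (\<lambda>i. 4 * x i) summable_on multi_indices n" "norm (4 * x (Suc n)) < 1"
  shows "G_term (Suc n) x summable_on multi_indices (Suc n)"
proof -
  have "(\<lambda>l. norm (G_term n (\<lambda>i. 4 * x i) l)) summable_on multi_indices n"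
    using assms(1) by (simp add: summable_on_iff_abs_summable_on_complex)
  moreover have "(\<lambda>m. norm ((4 * x (Suc n)) ^ m)) summable_on UNIV"
    unfolding norm_power using assms(2)
    by (subst summable_on_UNIV_nonneg_real_iff) (auto intro!: summable_geometric)
  ultimately have majorant: "(\<lambda>(l, m). norm (G_term n (\<lambda>i. 4 * x i) l * (4 * x (Suc n)) ^ m))
      summable_on multi_indices n \<times> UNIV"
    by (rule norm_summable_on_Times_mult)
  have "norm (G_term (Suc n) x (l(Suc n := m))) \<le>
      norm (G_term n (\<lambda>i. 4 * x i) l * (4 * x (Suc n)) ^ m)" for l m
  proof -
    let ?k = "\<Sum>i=1..n. l i"
    have "real (?k + m choose m) ^ 2 \<le> (2 ^ (?k + m)) ^ 2"
      by (intro power_mono) (simp_all add: binomial_le_pow2)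
    also have "\<dots> = 4 ^ ?k * 4 ^ m"
      by (simp add: power2_eq_square flip: power_mult_distrib power_add)
    finally have "norm (G_term n x l) * (real (?k + m choose m) ^ 2 * norm (x (Suc n)) ^ m) \<le>
        norm (G_term n x l) * (4 ^ ?k * 4 ^ m * norm (x (Suc n)) ^ m)"
      by (intro mult_right_mono mult_left_mono) auto
    then show ?thesis
      unfolding G_term_Suc G_term_scale
      by (simp add: norm_mult norm_power power_mult_distrib mult_ac)
  qed
  then have "(\<lambda>p. norm (G_term (Suc n) x (case p of (l, m) \<Rightarrow> l(Suc n := m))))
      summable_on multi_indices n \<times> UNIV"
    by (intro summable_on_comparison_test[OF majorant]) auto
  then have "(\<lambda>p. G_term (Suc n) x (case p of (l, m) \<Rightarrow> l(Suc n := m)))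
      summable_on multi_indices n \<times> UNIV"
    by (simp add: summable_on_iff_abs_summable_on_complex)
  then show ?thesis
    using summable_on_reindex_bij_betw[OF bij_betw_multi_indices_Suc] by blast
qed

lemma eventually_summable_on_G_term:
  "\<forall>\<^sub>F x in nhds_origin n. G_term n x summable_on multi_indices n"
proof (induction n)
  case 0
  show ?case by (simp add: multi_indices_0)
next
  case (Suc n)
  have "\<forall>\<^sub>F a in nhds 0. norm (4 * a :: complex) < 1"
    by (auto simp: eventually_nhds_metric norm_mult intro!: exI[of _ "1 / 4"])
  from eventually_nhds_origin_coordinate[OF this lessI]
    eventually_nhds_origin_dominated[OF Suc le_SucI[OF order.refl], of 4]
  show ?case
    by eventually_elim (auto intro!: summable_on_G_term_Suc simp: norm_mult)
qed

lemma G_0 [simp]: "G 0 x = 1"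
  by (simp add: G_def multi_indices_0)

lemma G_Suc:
  assumes "G_term (Suc n) x summable_on multi_indices (Suc n)"
  shows "G (Suc n) x =
    (\<Sum>\<^sub>\<infinity>l\<in>multi_indices n. G_term n x l * squared_binomial_series (\<Sum>i=1..n. l i) (x (Suc n)))"
proof -
  let ?append = "\<lambda>(l, m). l(Suc n := m)"
  have "(\<lambda>p. G_term (Suc n) x (?append p)) summable_on multi_indices n \<times> UNIV"
    using assms summable_on_reindex_bij_betw[OF bij_betw_multi_indices_Suc] by blast
  from infsum_Sigma_banach[OF this]
  have "(\<Sum>\<^sub>\<infinity>l\<in>multi_indices n. \<Sum>\<^sub>\<infinity>m. G_term (Suc n) x (l(Suc n := m))) =
      (\<Sum>\<^sub>\<infinity>p\<in>multi_indices n \<times> UNIV. G_term (Suc n) x (?append p))"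
    by simp
  also have "\<dots> = G (Suc n) x"
    unfolding G_def by (rule infsum_reindex_bij_betw[OF bij_betw_multi_indices_Suc])
  finally show ?thesis
    by (simp add: G_term_Suc infsum_cmult_right' squared_binomial_series_def)
qed

lemma negative_binomial_has_sum:
  fixes z :: complex
  assumes "norm z < 1"
  shows "((\<lambda>m. of_nat (k + m choose m) * z ^ m) has_sum 1 / (1 - z) ^ Suc k) UNIV"
proof -
  have sums: "(\<lambda>m. of_nat (k + m choose m) * w ^ m) sums (1 - w) powr (- of_nat (Suc k))"
    if "norm w < 1" for w :: complex
  proof -
    have "((of_nat (Suc k) + of_nat m - 1 :: complex) gchoose m) = of_nat (k + m choose m)" for m
      by (simp add: binomial_gbinomial)
    moreover have "(- 1) ^ m * c * (- w) ^ m = c * w ^ m" for c :: complex and m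
      by (simp add: power_minus[of w])
    ultimately show ?thesis
      using one_plus_neg_powr_powser[of "- w" "of_nat (Suc k)"] that
      by (simp only: norm_minus_cancel add_uminus_conv_diff)
  qed
  obtain r where r: "norm z < r" "r < 1" using dense[OF assms] by blast
  then have "norm (of_real r :: complex) = r"
    using norm_ge_zero[of z] by (simp del: norm_ge_zero)
  with r have "summable (\<lambda>m. norm (of_nat (k + m choose m) * z ^ m))"
    by (intro powser_insidea[OF sums_summable[OF sums], where x = "of_real r"]) auto
  moreover have "(1 - z) powr (- of_nat (Suc k)) = 1 / (1 - z) ^ Suc k"
    using assms by (auto simp: powr_minus powr_nat' field_simps simp del: of_nat_Suc power_Suc)
  ultimately show ?thesis
    using norm_summable_imp_has_sum[OF _ sums[OF assms]] by simp
qed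


section \<open>Smooth paths\<close>

lemma
  assumes "smooth_path \<gamma>"
  shows continuous_on_smooth_path_vector_derivative:
      "continuous_on {0..1} (\<lambda>s. vector_derivative \<gamma> (at s within {0..1}))"
    and smooth_path_has_vector_derivative: "s \<in> {0..1} \<Longrightarrow>
      (\<gamma> has_vector_derivative vector_derivative \<gamma> (at s within {0..1})) (at s within {0..1})"
proof -
  obtain \<gamma>' where \<gamma>': "continuous_on {0..1} \<gamma>'"
    "\<And>s. s \<in> {0..1} \<Longrightarrow> (\<gamma> has_vector_derivative \<gamma>' s) (at s within {0..1})"
    using assms by (auto simp: smooth_path_def)
  then have vector_derivative_eq: "vector_derivative \<gamma> (at s within {0..1}) = \<gamma>' s"
    if "s \<in> {0..1}" for s
    using that by (intro vector_derivative_within_closed_interval) auto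
  with \<gamma>'(1) show "continuous_on {0..1} (\<lambda>s. vector_derivative \<gamma> (at s within {0..1}))"
    by (subst continuous_on_cong[OF refl]) auto
  show "s \<in> {0..1} \<Longrightarrow>
      (\<gamma> has_vector_derivative vector_derivative \<gamma> (at s within {0..1})) (at s within {0..1})"
    using \<gamma>'(2) vector_derivative_eq by simp
qed

lemma smooth_path_imp_continuous_on:
  assumes "smooth_path \<gamma>"
  shows "continuous_on {0..1} \<gamma>"
  unfolding continuous_on_eq_continuous_within
  using has_vector_derivative_continuous[OF smooth_path_has_vector_derivative[OF assms]] by blast

lemma smooth_path_has_vector_derivative_interior:
  assumes "smooth_path \<gamma>" "s \<in> {0<..<1}"
  shows "(\<gamma> has_vector_derivative vector_derivative \<gamma> (at s within {0..1})) (at s)"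
proof -
  have "at s within {0..1} = at s"
    using assms(2) by (intro at_within_interior) auto
  then show ?thesis
    using smooth_path_has_vector_derivative[OF assms(1), of s] assms(2) by auto
qed

lemma smooth_path_imp_valid_path:
  assumes "smooth_path \<gamma>"
  shows "valid_path \<gamma>"
  unfolding valid_path_def piecewise_C1_differentiable_on_def C1_differentiable_on_def
proof (intro conjI exI[of _ "{0, 1}"] ballI
    exI[of _ "\<lambda>s. vector_derivative \<gamma> (at s within {0..1})"])
  show "continuous_on ({0..1} - {0, 1}) (\<lambda>s. vector_derivative \<gamma> (at s within {0..1}))"
    by (rule continuous_on_subset[OF continuous_on_smooth_path_vector_derivative[OF assms]]) auto
qed (use assms in
    \<open>auto intro!: smooth_path_imp_continuous_on smooth_path_has_vector_derivative_interior\<close>)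

lemma compact_smooth_path_image: "smooth_path \<gamma> \<Longrightarrow> compact (path_image \<gamma>)"
  by (intro compact_valid_path_image smooth_path_imp_valid_path)

text \<open>
  At the endpoints the two-sided derivative need not exist; its junk values there must be bounded
  for \<open>contour_integral_uniform_limit\<close> to apply.
\<close>

lemma bounded_smooth_path_vector_derivative:
  assumes "smooth_path \<gamma>"
  shows "bounded ((\<lambda>s. vector_derivative \<gamma> (at s)) ` {0..1})"
proof (rule bounded_subset)
  let ?interior = "(\<lambda>s. vector_derivative \<gamma> (at s within {0..1})) ` {0..1}"
    and ?endpoints = "{vector_derivative \<gamma> (at 0), vector_derivative \<gamma> (at 1)}"
  show "bounded (?interior \<union> ?endpoints)"
    using continuous_on_smooth_path_vector_derivative[OF assms]
    by (auto intro!: compact_imp_bounded compact_continuous_image)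
  show "(\<lambda>s. vector_derivative \<gamma> (at s)) ` {0..1} \<subseteq> ?interior \<union> ?endpoints"
  proof (rule image_subsetI)
    fix s :: real assume "s \<in> {0..1}"
    then consider "s = 0" | "s = 1" | "s \<in> {0<..<1}" by fastforce
    then show "vector_derivative \<gamma> (at s) \<in> ?interior \<union> ?endpoints"
    proof cases
      assume "s \<in> {0<..<1}"
      then have "vector_derivative \<gamma> (at s) = vector_derivative \<gamma> (at s within {0..1})"
        by (intro vector_derivative_at smooth_path_has_vector_derivative_interior assms)
      with \<open>s \<in> {0..1}\<close> show ?thesis by blast
    qed auto
  qed
qed


section \<open>Integrals over powers of a path\<close>

lemma
  fixes f :: "('i \<Rightarrow> 'a) \<Rightarrow> 'b::{banach, second_countable_topology}"
  assumes prob: "\<And>j. j \<in> insert i I \<Longrightarrow> prob_space (M j)"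
    and integrable_f: "integrable (Pi\<^sub>M (insert i I) M) f"
  shows integrable_integral_PiM_upd: "integrable (M i) (\<lambda>y. \<integral>s. f (s(i := y)) \<partial>Pi\<^sub>M I M)"
    and integral_PiM_insert:
      "integral\<^sup>L (Pi\<^sub>M (insert i I) M) f = (\<integral>y. \<integral>s. f (s(i := y)) \<partial>Pi\<^sub>M I M \<partial>M i)"
proof -
  interpret pair_prob_space "M i" "Pi\<^sub>M I M"
    using prob by (intro pair_prob_space.intro pair_sigma_finite.intro prob_space_imp_sigma_finite
        prob_space_PiM) auto
  let ?upd = "\<lambda>(y, s). s(i := y)"
  have distr: "distr (M i \<Otimes>\<^sub>M Pi\<^sub>M I M) (Pi\<^sub>M (insert i I) M) ?upd = Pi\<^sub>M (insert i I) M"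
    using prob by (intro distr_pair_PiM_eq_PiM) auto
  have upd: "?upd \<in> measurable (M i \<Otimes>\<^sub>M Pi\<^sub>M I M) (Pi\<^sub>M (insert i I) M)"
    by measurable
  have integrable_upd: "integrable (M i \<Otimes>\<^sub>M Pi\<^sub>M I M) (\<lambda>p. f (?upd p))"
    using integrable_f by (intro integrable_distr[OF upd]) (simp only: distr)
  from integrable_fst'[OF this]
  show "integrable (M i) (\<lambda>y. \<integral>s. f (s(i := y)) \<partial>Pi\<^sub>M I M)"
    by simp
  have "integral\<^sup>L (Pi\<^sub>M (insert i I) M) f = (\<integral>p. f (?upd p) \<partial>(M i \<Otimes>\<^sub>M Pi\<^sub>M I M))"
    using integral_distr[OF upd, of f] integrable_f by (simp add: distr)
  also have "\<dots> = (\<integral>y. \<integral>s. f (s(i := y)) \<partial>Pi\<^sub>M I M \<partial>M i)"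
    using integral_fst'[OF integrable_upd] by simp
  finally show "integral\<^sup>L (Pi\<^sub>M (insert i I) M) f = (\<integral>y. \<integral>s. f (s(i := y)) \<partial>Pi\<^sub>M I M \<partial>M i)" .
qed

abbreviation unit_interval_measure :: "real measure" where
  "unit_interval_measure \<equiv> restrict_space lborel {0..1}"

lemma prob_space_unit_interval_measure: "prob_space unit_interval_measure"
  by (rule prob_space_restrict_space) simp_all

lemma prob_space_unit_cube_measure: "prob_space (unit_cube_measure n)"
  unfolding unit_cube_measure_def by (intro prob_space_PiM prob_space_unit_interval_measure)

lemma borel_measurable_unit_cube_component:
  fixes h :: "real \<Rightarrow> 'a::topological_space"
  assumes "continuous_on {0..1} h" "i \<in> {1..n}"
  shows "(\<lambda>s. h (s i)) \<in> borel_measurable (unit_cube_measure n)"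
proof -
  have "sets unit_interval_measure = sets (restrict_space borel {0..1})"
    by (intro sets_restrict_space_cong) simp
  with assms(1) have [measurable]: "h \<in> borel_measurable unit_interval_measure"
    using borel_measurable_continuous_on_restrict measurable_cong_sets by blast
  from assms(2) show ?thesis
    unfolding unit_cube_measure_def by measurable
qed

lemma path_power_integrableI_bounded:
  assumes \<gamma>: "smooth_path \<gamma>"
    and measurable: "(\<lambda>s. f (\<lambda>i. \<gamma> (s i))) \<in> borel_measurable (unit_cube_measure n)"
    and bounded: "\<And>t. (\<forall>i\<in>{1..n}. t i \<in> path_image \<gamma>) \<Longrightarrow> norm (f t) \<le> B"
  shows "path_power_integrable n \<gamma> f"
proof -
  let ?V = "\<lambda>s. vector_derivative \<gamma> (at s within {0..1})"
  note continuous_derivative = continuous_on_smooth_path_vector_derivative[OF \<gamma>]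
  interpret prob_space "unit_cube_measure n"
    by (rule prob_space_unit_cube_measure)
  obtain D where D: "\<And>s. s \<in> {0..1} \<Longrightarrow> norm (?V s) \<le> D"
    using continuous_on_compact_bound[OF compact_Icc continuous_derivative] by blast
  show ?thesis
    unfolding path_power_integrable_def
  proof (rule integrable_const_bound[where B = "B * D ^ n"])
    show "path_power_pullback n \<gamma> f \<in> borel_measurable (unit_cube_measure n)"
      unfolding path_power_pullback_def
      by (intro borel_measurable_times borel_measurable_prod measurable
          borel_measurable_unit_cube_component[OF continuous_derivative])
    show "AE s in unit_cube_measure n. norm (path_power_pullback n \<gamma> f s) \<le> B * D ^ n"
    proof (rule AE_I2)
      fix s assume "s \<in> space (unit_cube_measure n)"
      then have s: "s i \<in> {0..1}" if "i \<in> {1..n}" for i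
        using that by (auto simp: unit_cube_measure_def space_PiM space_restrict_space)
      have "norm (f (\<lambda>i. \<gamma> (s i))) \<le> B"
        using s by (intro bounded) (auto simp: path_image_def)
      moreover have "norm (\<Prod>i=1..n. ?V (s i)) \<le> (\<Prod>i=1..n. D)"
        unfolding prod_norm[symmetric] using s D by (intro prod_mono) auto
      then have "norm (\<Prod>i=1..n. ?V (s i)) \<le> D ^ n"
        by simp
      ultimately show "norm (path_power_pullback n \<gamma> f s) \<le> B * D ^ n"
        unfolding path_power_pullback_def norm_mult by (meson mult_mono norm_ge_zero order_trans)
    qed
  qed
qed

lemma path_power_integral_0 [simp]: "path_power_integral 0 \<gamma> (\<lambda>_. c) = c"
  by (simp add: path_power_integral_def path_power_pullback_def unit_cube_measure_def PiM_empty
    lebesgue_integral_count_space_finite)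

lemma path_power_integral_mult_right:
  "path_power_integral n \<gamma> (\<lambda>t. f t * c) = path_power_integral n \<gamma> f * c"
proof -
  have "path_power_pullback n \<gamma> (\<lambda>t. f t * c) = (\<lambda>s. path_power_pullback n \<gamma> f s * c)"
    by (simp add: path_power_pullback_def fun_eq_iff)
  then show ?thesis by (simp add: path_power_integral_def)
qed

lemma path_power_pullback_Suc:
  "path_power_pullback (Suc n) \<gamma> f (s(Suc n := y)) =
     path_power_pullback n \<gamma> (\<lambda>t. f (t(Suc n := \<gamma> y))) s * vector_derivative \<gamma> (at y within {0..1})"
proof -
  have "(\<lambda>i. \<gamma> ((s(Suc n := y)) i)) = (\<lambda>i. \<gamma> (s i))(Suc n := \<gamma> y)"
    by auto
  moreover have "(\<Prod>i=1..n. vector_derivative \<gamma> (at ((s(Suc n := y)) i) within {0..1})) =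
      (\<Prod>i=1..n. vector_derivative \<gamma> (at (s i) within {0..1}))"
    by (rule prod.cong) auto
  ultimately show ?thesis
    by (simp add: path_power_pullback_def)
qed

lemma integral_unit_interval_eq_contour_integral:
  assumes "integrable unit_interval_measure
    (\<lambda>s. f (\<gamma> s) * vector_derivative \<gamma> (at s within {0..1}))"
  shows "(\<integral>s. f (\<gamma> s) * vector_derivative \<gamma> (at s within {0..1}) \<partial>unit_interval_measure) =
    contour_integral \<gamma> f"
proof -
  let ?g = "\<lambda>s. f (\<gamma> s) * vector_derivative \<gamma> (at s within {0..1})"
  have "set_integrable lborel {0..1} ?g"
    using assms by (simp add: integrable_restrict_space set_integrable_def)
  from set_borel_integral_eq_integral[OF this]
  have "(?g has_integral (\<integral>s. ?g s \<partial>unit_interval_measure)) {0..1}"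
    by (simp add: integral_restrict_space set_lebesgue_integral_def has_integral_iff)
  then have "(f has_contour_integral (\<integral>s. ?g s \<partial>unit_interval_measure)) \<gamma>"
    by (simp add: has_contour_integral_def)
  from contour_integral_unique[OF this] show ?thesis ..
qed

lemma path_power_integral_Suc:
  assumes "path_power_integrable (Suc n) \<gamma> f"
  shows "path_power_integral (Suc n) \<gamma> f =
    contour_integral \<gamma> (\<lambda>z. path_power_integral n \<gamma> (\<lambda>t. f (t(Suc n := z))))"
proof -
  let ?F = "path_power_pullback (Suc n) \<gamma> f"
  let ?J = "\<lambda>z. path_power_integral n \<gamma> (\<lambda>t. f (t(Suc n := z)))"
  let ?V = "\<lambda>y. vector_derivative \<gamma> (at y within {0..1})"
  have cube: "unit_cube_measure (Suc n) = Pi\<^sub>M (insert (Suc n) {1..n}) (\<lambda>_. unit_interval_measure)"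
    by (simp add: unit_cube_measure_def atLeastAtMostSuc_conv)
  have integrable_pullback:
    "integrable (Pi\<^sub>M (insert (Suc n) {1..n}) (\<lambda>_. unit_interval_measure)) ?F"
    using assms by (simp add: path_power_integrable_def cube)
  have inner: "(\<integral>s. ?F (s(Suc n := y)) \<partial>Pi\<^sub>M {1..n} (\<lambda>_. unit_interval_measure)) =
      ?J (\<gamma> y) * ?V y" for y
    by (simp add: path_power_pullback_Suc path_power_integral_def unit_cube_measure_def)
  have "path_power_integral (Suc n) \<gamma> f = (\<integral>y. ?J (\<gamma> y) * ?V y \<partial>unit_interval_measure)"
    using integral_PiM_insert[OF prob_space_unit_interval_measure integrable_pullback]
    unfolding path_power_integral_def[of "Suc n"] cube inner .
  also have "\<dots> = contour_integral \<gamma> ?J"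
    using integrable_integral_PiM_upd[OF prob_space_unit_interval_measure integrable_pullback]
    unfolding inner by (rule integral_unit_interval_eq_contour_integral)
  finally show ?thesis .
qed

lemma path_power_integral_S_integrand_Suc:
  assumes "path_power_integrable (Suc n) \<gamma> (S_integrand (Suc n) x)"
  shows "path_power_integral (Suc n) \<gamma> (S_integrand (Suc n) x) = contour_integral \<gamma>
    (\<lambda>z. path_power_integral n \<gamma> (S_integrand n (\<lambda>i. S1 (x (Suc n)) z * x i)) *
      S1_cancelled (x (Suc n)) z)"
  by (simp add: path_power_integral_Suc[OF assms] S_integrand_Suc_upd
      path_power_integral_mult_right)


section \<open>Contour integrals\<close>

lemma has_contour_integral_infsum:
  assumes \<gamma>: "valid_path \<gamma>" "bounded ((\<lambda>s. vector_derivative \<gamma> (at s)) ` {0..1})"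
    and integrals: "\<And>i. i \<in> I \<Longrightarrow> (f i has_contour_integral c i) \<gamma>"
    and majorant: "\<And>i z. i \<in> I \<Longrightarrow> z \<in> path_image \<gamma> \<Longrightarrow> norm (f i z) \<le> M i" "M summable_on I"
    and sum: "\<And>z. z \<in> path_image \<gamma> \<Longrightarrow> ((\<lambda>i. f i z) has_sum F z) I"
  shows "(F has_contour_integral (\<Sum>\<^sub>\<infinity>i\<in>I. c i)) \<gamma>"
proof -
  obtain B where B: "\<And>s. s \<in> {0..1} \<Longrightarrow> norm (vector_derivative \<gamma> (at s)) \<le> B"
    using \<gamma>(2) unfolding bounded_iff by blast
  have uniform: "uniform_limit (path_image \<gamma>) (\<lambda>X z. \<Sum>i\<in>X. f i z) F (finite_subsets_at_top I)"
    by (rule Weierstrass_m_test_general'[OF majorant(1) sum majorant(2)])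
  have partial_sums: "\<forall>\<^sub>F X in finite_subsets_at_top I.
      ((\<lambda>z. \<Sum>i\<in>X. f i z) has_contour_integral (\<Sum>i\<in>X. c i)) \<gamma>"
    by (rule eventually_finite_subsets_at_top_weakI)
       (auto intro!: has_contour_integral_sum integrals)
  then have "\<forall>\<^sub>F X in finite_subsets_at_top I. (\<lambda>z. \<Sum>i\<in>X. f i z) contour_integrable_on \<gamma>"
    by eventually_elim (auto simp: contour_integrable_on_def)
  note limit = contour_integral_uniform_limit[OF this uniform B \<gamma>(1) finite_subsets_at_top_neq_bot]
  from partial_sums have "\<forall>\<^sub>F X in finite_subsets_at_top I.
      contour_integral \<gamma> (\<lambda>z. \<Sum>i\<in>X. f i z) = (\<Sum>i\<in>X. c i)"
    by eventually_elim (rule contour_integral_unique)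
  with limit(2) have "(c has_sum contour_integral \<gamma> F) I"
    unfolding has_sum_def by (rule Lim_transform_eventually)
  then show ?thesis
    using has_contour_integral_integral[OF limit(1)] by (simp add: infsumI)
qed

lemma homotopic_loops_notin_path_image:
  assumes "homotopic_loops (- {a}) p q"
  shows "a \<notin> path_image p"
  using homotopic_loops_imp_subset[OF assms] by auto

lemma has_contour_integral_higher_deriv_homotopic_circlepath:
  assumes \<gamma>: "valid_path \<gamma>" "homotopic_loops (- {w}) \<gamma> (circlepath w R)" and "0 < R"
    and holomorphic: "f holomorphic_on UNIV"
  shows "((\<lambda>z. f z / (z - w) ^ Suc k) has_contour_integral
    (2 * pi * \<i>) / fact k * (deriv ^^ k) f w) \<gamma>"
proof -
  let ?g = "\<lambda>z. f z / (z - w) ^ Suc k"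
  have quotient_holomorphic: "?g holomorphic_on - {w}"
    by (auto intro!: holomorphic_intros holomorphic_on_subset[OF holomorphic])
  have "contour_integral \<gamma> ?g = contour_integral (circlepath w R) ?g"
    by (rule Cauchy_theorem_homotopic_loops[OF _ _ quotient_holomorphic]) (use \<gamma> in auto)
  also have "\<dots> = (2 * pi * \<i>) / fact k * (deriv ^^ k) f w"
    by (intro contour_integral_unique Cauchy_has_contour_integral_higher_derivative_circlepath
        holomorphic_on_imp_continuous_on holomorphic_on_subset[OF holomorphic])
       (use \<open>0 < R\<close> in auto)
  finally have "contour_integral \<gamma> ?g = (2 * pi * \<i>) / fact k * (deriv ^^ k) f w" .
  moreover have "?g contour_integrable_on \<gamma>"
    by (rule contour_integrable_holomorphic_simple[OF quotient_holomorphic _ \<gamma>(1)])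
       (use homotopic_loops_notin_path_image[OF \<gamma>(2)] in auto)
  ultimately show ?thesis
    using has_contour_integral_integral by metis
qed

lemma has_contour_integral_power_over_shifted_power:
  assumes "valid_path \<gamma>" "homotopic_loops (- {1}) \<gamma> (circlepath 1 R)" "0 < R"
  shows "((\<lambda>z. z ^ (k + m) / (z - 1) ^ Suc k) has_contour_integral
    2 * of_real pi * \<i> * of_nat (k + m choose m)) \<gamma>"
proof -
  have "(deriv ^^ k) (\<lambda>z. z ^ (k + m)) (1 :: complex) = pochhammer (of_nat (Suc m)) k"
    using higher_deriv_power[of k 0 "k + m" 1] by (simp del: of_nat_Suc)
  also have "\<dots> = fact (k + m) / fact m"
    using pochhammer_product[of m "k + m" "1 :: complex"]
    by (simp add: add.commute flip: pochhammer_fact)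
  finally have "(2 * pi * \<i>) / fact k * (deriv ^^ k) (\<lambda>z. z ^ (k + m)) 1 =
      2 * of_real pi * \<i> * of_nat (k + m choose m)"
    by (simp add: binomial_fact field_simps)
  moreover have "(\<lambda>z. z ^ (k + m) :: complex) holomorphic_on UNIV"
    by (intro holomorphic_intros)
  ultimately show ?thesis
    using has_contour_integral_higher_deriv_homotopic_circlepath[OF assms] by metis
qed

lemma has_contour_integral_negative_binomial:
  assumes \<gamma>: "smooth_path \<gamma>" and continuous: "continuous_on (path_image \<gamma>) g"
    and moments: "\<And>m. ((\<lambda>z. z ^ m * g z) has_contour_integral c m) \<gamma>"
    and norm_xz_less: "\<And>z. z \<in> path_image \<gamma> \<Longrightarrow> norm (x * z) < 1"
  shows "((\<lambda>z. 1 / (1 - x * z) ^ Suc k * g z) has_contour_integral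
    (\<Sum>\<^sub>\<infinity>m. of_nat (k + m choose m) * x ^ m * c m)) \<gamma>"
proof -
  note compact = compact_smooth_path_image[OF \<gamma>]
  obtain r where r: "r < 1" "\<And>z. z \<in> path_image \<gamma> \<Longrightarrow> norm (x * z) \<le> r"
    using continuous_attains_sup[OF compact path_image_nonempty, of "\<lambda>z. norm (x * z)"] norm_xz_less
    by (force intro!: continuous_intros)
  have "0 \<le> r"
    using order_trans[OF norm_ge_zero r(2)[OF pathstart_in_path_image]] .
  obtain B where B: "\<And>z. z \<in> path_image \<gamma> \<Longrightarrow> norm (g z) \<le> B"
    using continuous_on_compact_bound[OF compact continuous] by blast
  show ?thesis
  proof (rule has_contour_integral_infsum[OF smooth_path_imp_valid_path[OF \<gamma>]
        bounded_smooth_path_vector_derivative[OF \<gamma>]])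
    show "((\<lambda>z. of_nat (k + m choose m) * (x * z) ^ m * g z) has_contour_integral
        of_nat (k + m choose m) * x ^ m * c m) \<gamma>" for m
      using has_contour_integral_lmul[OF moments, of "of_nat (k + m choose m) * x ^ m" m]
      by (simp add: power_mult_distrib mult_ac)
    show "norm (of_nat (k + m choose m) * (x * z) ^ m * g z) \<le>
        norm (of_nat (k + m choose m) * of_real r ^ m :: complex) * B"
      if z: "z \<in> path_image \<gamma>" for m z
    proof -
      have "norm (x * z) ^ m \<le> r ^ m"
        using r(2)[OF z] by (intro power_mono) auto
      then have "norm (of_nat (k + m choose m) * (x * z) ^ m) \<le>
          norm (of_nat (k + m choose m) * of_real r ^ m :: complex)"
        using \<open>0 \<le> r\<close> unfolding norm_mult norm_power by (intro mult_left_mono) auto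
      then show ?thesis
        unfolding norm_mult[of _ "g z"] by (intro mult_mono B[OF z]) auto
    qed
    have "(\<lambda>m. of_nat (k + m choose m) * of_real r ^ m :: complex) summable_on UNIV"
      using has_sum_imp_summable[OF negative_binomial_has_sum] r(1) \<open>0 \<le> r\<close> by simp
    then show "(\<lambda>m. norm (of_nat (k + m choose m) * of_real r ^ m :: complex) * B) summable_on UNIV"
      by (intro summable_on_cmult_left) (simp only: summable_on_iff_abs_summable_on_complex)
    show "((\<lambda>m. of_nat (k + m choose m) * (x * z) ^ m * g z) has_sum
        1 / (1 - x * z) ^ Suc k * g z) UNIV" if "z \<in> path_image \<gamma>" for z
      by (rule has_sum_cmult_left[OF negative_binomial_has_sum[OF norm_xz_less[OF that]]])
  qed
qed

text \<open>
  One binomial factor comes from expanding \<open>1 / (1 - x z)\<^sup>k\<^sup>+\<^sup>1\<close>, the other from the residue at \<open>1\<close>.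
\<close>

lemma has_contour_integral_S1_power:
  assumes \<gamma>: "smooth_path \<gamma>" "homotopic_loops (- {1}) \<gamma> (circlepath 1 R)" and "0 < R"
    and norm_xz_less: "\<And>z. z \<in> path_image \<gamma> \<Longrightarrow> norm (x * z) < 1"
  shows "((\<lambda>z. S1 x z ^ k * S1_cancelled x z) has_contour_integral
    2 * of_real pi * \<i> * squared_binomial_series k x) \<gamma>"
proof -
  let ?g = "\<lambda>z. z ^ k / (z - 1) ^ Suc k"
  have "continuous_on (path_image \<gamma>) ?g"
    using homotopic_loops_notin_path_image[OF \<gamma>(2)] by (auto intro!: continuous_intros)
  moreover have "((\<lambda>z. z ^ m * ?g z) has_contour_integral
      2 * of_real pi * \<i> * of_nat (k + m choose m)) \<gamma>" for m
    using has_contour_integral_power_over_shifted_power[OF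
        smooth_path_imp_valid_path[OF \<gamma>(1)] \<gamma>(2) \<open>0 < R\<close>]
    by (simp add: power_add mult.commute)
  ultimately have "((\<lambda>z. 1 / (1 - x * z) ^ Suc k * ?g z) has_contour_integral
      (\<Sum>\<^sub>\<infinity>m. of_nat (k + m choose m) * x ^ m * (2 * of_real pi * \<i> * of_nat (k + m choose m)))) \<gamma>"
    by (rule has_contour_integral_negative_binomial[OF \<gamma>(1) _ _ norm_xz_less])
  moreover have "1 / (1 - x * z) ^ Suc k * ?g z = S1 x z ^ k * S1_cancelled x z" for z
    by (simp add: S1_def S1_cancelled_def power_divide power_mult_distrib mult_ac)
  moreover have
    "(\<Sum>\<^sub>\<infinity>m. of_nat (k + m choose m) * x ^ m * (2 * of_real pi * \<i> * of_nat (k + m choose m))) =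
      2 * of_real pi * \<i> * squared_binomial_series k x"
    by (simp add: squared_binomial_series_def power2_eq_square mult_ac flip: infsum_cmult_right')
  ultimately show ?thesis by (simp only:)
qed

lemma has_contour_integral_G_Suc:
  assumes \<gamma>: "smooth_path \<gamma>" "homotopic_loops (- {1}) \<gamma> (circlepath 1 R)" and "0 < R"
    and norm_xz_less: "\<And>z. z \<in> path_image \<gamma> \<Longrightarrow> norm (x (Suc n) * z) < 1"
    and C: "\<And>z. z \<in> path_image \<gamma> \<Longrightarrow> norm (S1 (x (Suc n)) z) \<le> C"
    and D: "\<And>z. z \<in> path_image \<gamma> \<Longrightarrow> norm (S1_cancelled (x (Suc n)) z) \<le> D"
    and summable: "G_term n (\<lambda>i. of_real C * x i) summable_on multi_indices n"
      "G_term (Suc n) x summable_on multi_indices (Suc n)"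
  shows "((\<lambda>z. G n (\<lambda>i. S1 (x (Suc n)) z * x i) * S1_cancelled (x (Suc n)) z) has_contour_integral
    2 * of_real pi * \<i> * G (Suc n) x) \<gamma>"
proof -
  let ?c = "S1 (x (Suc n))" and ?w = "S1_cancelled (x (Suc n))"
  have norm_c_le: "norm (?c z) \<le> norm (of_real C :: complex)" if "z \<in> path_image \<gamma>" for z
    using C[OF that] by simp
  have "((\<lambda>z. G n (\<lambda>i. ?c z * x i) * ?w z) has_contour_integral
      (\<Sum>\<^sub>\<infinity>l\<in>multi_indices n. G_term n x l *
        (2 * of_real pi * \<i> * squared_binomial_series (\<Sum>i=1..n. l i) (x (Suc n))))) \<gamma>"
  proof (rule has_contour_integral_infsum[OF smooth_path_imp_valid_path[OF \<gamma>(1)]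
        bounded_smooth_path_vector_derivative[OF \<gamma>(1)]])
    fix l
    have "G_term n (\<lambda>i. ?c z * x i) l * ?w z = G_term n x l * (?c z ^ (\<Sum>i=1..n. l i) * ?w z)" for z
      by (simp add: G_term_scale)
    then show "((\<lambda>z. G_term n (\<lambda>i. ?c z * x i) l * ?w z) has_contour_integral G_term n x l *
        (2 * of_real pi * \<i> * squared_binomial_series (\<Sum>i=1..n. l i) (x (Suc n)))) \<gamma>"
      by (simp only: has_contour_integral_lmul[OF
            has_contour_integral_S1_power[OF \<gamma> \<open>0 < R\<close> norm_xz_less]])
    show "norm (G_term n (\<lambda>i. ?c z * x i) l * ?w z) \<le> norm (G_term n (\<lambda>i. of_real C * x i) l) * D"
      if "z \<in> path_image \<gamma>" for z
      unfolding norm_mult[of _ "?w z"]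
      by (intro mult_mono norm_G_term_scale_mono norm_c_le D that) auto
    show "(\<lambda>l. norm (G_term n (\<lambda>i. of_real C * x i) l) * D) summable_on multi_indices n"
      using summable(1) unfolding summable_on_iff_abs_summable_on_complex
      by (rule summable_on_cmult_left)
    show "((\<lambda>l. G_term n (\<lambda>i. ?c z * x i) l * ?w z) has_sum G n (\<lambda>i. ?c z * x i) * ?w z)
        (multi_indices n)" if "z \<in> path_image \<gamma>" for z
      unfolding G_def
      by (intro has_sum_cmult_left has_sum_infsum summable_on_G_term_scale[OF summable(1)]
          norm_c_le that)
  qed
  then show ?thesis
    by (simp add: G_Suc[OF summable(2)] mult_ac flip: infsum_cmult_right')
qed


section \<open>The integral representation\<close>

lemma eventually_path_power_integrable_S_integrand:
  assumes "smooth_path \<gamma>" "1 \<notin> path_image \<gamma>"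
  shows "\<forall>\<^sub>F x in nhds_origin n. path_power_integrable n \<gamma> (S_integrand n x)"
proof -
  have "(\<lambda>s. S_integrand n x (\<lambda>i. \<gamma> (s i))) \<in> borel_measurable (unit_cube_measure n)" for x
    by (intro borel_measurable_S_integrand borel_measurable_const
        borel_measurable_unit_cube_component smooth_path_imp_continuous_on assms)
  moreover obtain B where "\<forall>\<^sub>F x in nhds_origin n.
      \<forall>t. (\<forall>i\<in>{1..n}. t i \<in> path_image \<gamma>) \<longrightarrow> norm (S_integrand n x t) \<le> B"
    using S_integrand_bounded_near_origin[OF compact_smooth_path_image[OF assms(1)] assms(2)]
    by blast
  ultimately show ?thesis
    by (auto elim!: eventually_mono
        intro!: path_power_integrableI_bounded[OF assms(1), where B = B])
qed

lemma eventually_path_power_integral_S_integrand: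
  assumes \<gamma>: "smooth_path \<gamma>" "homotopic_loops (- {1}) \<gamma> (circlepath 1 R)" and "0 < R"
  shows "\<forall>\<^sub>F x in nhds_origin n.
    path_power_integral n \<gamma> (S_integrand n x) = (2 * of_real pi * \<i>) ^ n * G n x"
proof (induction n)
  case 0
  show ?case by simp
next
  case (Suc n)
  note one_notin = homotopic_loops_notin_path_image[OF \<gamma>(2)]
  obtain C where C: "\<forall>\<^sub>F a in nhds 0. \<forall>z\<in>path_image \<gamma>.
      norm (a * z) < 1 \<and> norm (S1 a z) \<le> C \<and> norm (S1_cancelled a z) \<le> C"
    using S1_bounded_near_0[OF compact_smooth_path_image[OF \<gamma>(1)] one_notin] .
  from eventually_nhds_origin_dominated[OF Suc le_SucI[OF order.refl], of C]
    eventually_nhds_origin_dominated[OF eventually_summable_on_G_term le_SucI[OF order.refl],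
      of n "\<bar>C\<bar>"]
    eventually_nhds_origin_coordinate[OF C lessI]
    eventually_summable_on_G_term[of "Suc n"]
    eventually_path_power_integrable_S_integrand[OF \<gamma>(1) one_notin, of "Suc n"]
  show ?case
  proof eventually_elim
    case (elim x)
    let ?c = "S1 (x (Suc n))" and ?w = "S1_cancelled (x (Suc n))"
    have IH: "path_power_integral n \<gamma> (S_integrand n (\<lambda>i. ?c z * x i)) =
        (2 * of_real pi * \<i>) ^ n * G n (\<lambda>i. ?c z * x i)" if "z \<in> path_image \<gamma>" for z
      using elim(1,3) that by (simp add: norm_mult mult_right_mono)
    have "G_term n (\<lambda>i. of_real C * x i) summable_on multi_indices n"
      using elim(2) by (simp add: norm_mult)
    then have "((\<lambda>z. G n (\<lambda>i. ?c z * x i) * ?w z) has_contour_integral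
        2 * of_real pi * \<i> * G (Suc n) x) \<gamma>"
      using elim(3,4) by (intro has_contour_integral_G_Suc[OF \<gamma> \<open>0 < R\<close>]) auto
    note integral_G = has_contour_integral_lmul[OF this, of "(2 * of_real pi * \<i>) ^ n"]
    have "path_power_integral (Suc n) \<gamma> (S_integrand (Suc n) x) =
        contour_integral \<gamma> (\<lambda>z. (2 * of_real pi * \<i>) ^ n * (G n (\<lambda>i. ?c z * x i) * ?w z))"
      unfolding path_power_integral_S_integrand_Suc[OF elim(5)]
      by (intro contour_integral_eq) (simp add: IH)
    also have "\<dots> = (2 * of_real pi * \<i>) ^ Suc n * G (Suc n) x"
      using contour_integral_unique[OF integral_G] by simp
    finally show ?case .
  qed
qed

theorem theorem1p2:
  fixes n :: nat and \<gamma> :: "real \<Rightarrow> complex" and R :: real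
  assumes "n \<ge> 1"
    and "smooth_path \<gamma>"
    and "0 < R" and "R < 1"
    and "homotopic_loops (- {1}) \<gamma> (circlepath 1 R)"
  shows "\<exists>\<epsilon>>0. \<forall>x :: nat \<Rightarrow> complex. (\<forall>i\<in>{1..n}. cmod (x i) < \<epsilon>) \<longrightarrow>
           G_term n x summable_on multi_indices n \<and>
           path_power_integrable n \<gamma> (S_integrand n x) \<and>
           G n x = 1 / (2 * of_real pi * \<i>) ^ n * path_power_integral n \<gamma> (S_integrand n x)"
  unfolding eventually_nhds_origin[symmetric]
proof (intro eventually_conj)
  show "\<forall>\<^sub>F x in nhds_origin n. G_term n x summable_on multi_indices n"
    by (rule eventually_summable_on_G_term)
  show "\<forall>\<^sub>F x in nhds_origin n. path_power_integrable n \<gamma> (S_integrand n x)"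
    by (intro eventually_path_power_integrable_S_integrand assms(2)
        homotopic_loops_notin_path_image[OF assms(5)])
  show "\<forall>\<^sub>F x in nhds_origin n.
      G n x = 1 / (2 * of_real pi * \<i>) ^ n * path_power_integral n \<gamma> (S_integrand n x)"
    using eventually_path_power_integral_S_integrand[OF assms(2,5,3)]
    by eventually_elim simp
qed

end
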